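(* Assume PIMP programs contain no semantic variables from $SVar$. Let $\Gamma,\Gamma'$ be matching logic patterns such that the correctness pair $\Gamma\Downarrow\Gamma'$ is derivable in the matching logic proof system for PIMP, let $\tau:SVar\to\mathcal T$, and let $\sigma=\gamma_0\xrightarrow{L}\gamma_1\xrightarrow{L}\cdots\xrightarrow{L}\gamma_n$ be any actual execution. If $(\gamma_0,\tau)\models\Gamma$, then $(\gamma_n,\tau)\models\Gamma'$.
   Context: Operational semantics of PIMP. Computations: $C::= x:=e\mid if\,(b)\,C_1\,else\,C_2\mid C_1;C_2\mid while\;b\;do\;C\mid C_1\parallel C_2\mid await\;b\;then\;cc\mid skip\mid A:=Array(e_1,\dots,e_n)\mid A[e_1]:=e_2\mid x:=A[e]$, where $e$ are integer expressions, $b$ boolean expressions, and $cc$ ranges over computations containing no $while$, $\parallel$, $await$; $\cdot$ is the empty computation ($\cdot;c=c$, $\cdot\parallel c=c=c\parallel\cdot$). Configurations $\langle c\rangle_k\langle\rho\rangle_{env}\langle m\rangle_{mem}$ (abbreviated $\langle c\rangle\langle\rho\rangle\langle m\rangle$), with $\rho$ a finite partial map variables$\to$integers, $m$ a finite partial map positive naturals$\to$integers; final if $c=\cdot$. Labelled transitions: $P$-steps: $skip\to\cdot$; $x:=e$ sets $\rho[\rho(e)/x]$; $x:=A[e]$ sets $\rho[m(\rho(A)+\rho(e))/x]$; $A[e_1]:=e_2$ sets $m[\rho(e_2)/(\rho(A)+\rho(e_1))]$; $A:=Array(\bar e)$ sets $\rho[p/A]$ and adds $p\mapsto[\rho(\bar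 e)]$ (i.e. $p+i-1\mapsto\rho(e_i)$) to $m$ for a fresh positive $p$; $if$ steps to the branch selected by $\rho(b)$; $while\;b\;do\;c$ steps to $c;while\;b\;do\;c$ if $\rho(b)$ true, else to $\cdot$; $await\;b\;then\;cc$ steps in one $P$-step to $\langle\cdot\rangle\langle\rho'\rangle\langle m'\rangle$ if $\rho(b)$ is true and $\langle cc\rangle\langle\rho\rangle\langle m\rangle\xrightarrow{P}^*\langle\cdot\rangle\langle\rho'\rangle\langle m'\rangle$; $P$-steps propagate to the left of $;$ and to either side of $\parallel$. $E$-step: $\langle c\rangle\langle\rho\rangle\langle m\rangle\xrightarrow{E}\langle c\rangle\langle\rho'\rangle\langle m'\rangle$ for arbitrary $\rho',m'$ (interference by other processes). An execution is a sequence of such steps; it is terminable if finite and eventually final. $\mathcal T$ is the initial model (ground terms). Patterns. $SVar$ is an infinite set of semantic (logical) variables, plus a distinguished variable $o$ of sort configuration. A pattern is $\exists X((o=\langle c\rangle_k\langle\rho\rangle_{env}\langle m\rangle_{mem})\land\varphi)$, with $X\subseteq SVar$, the configuration term possibly containing variables of $SVar$, and $\varphi$ a first-order formula; written $\langle c\rangle_k\langle\rho\rangle_{env}\langle m\rangle_{mem}\langle X\rangle_{bnd}\langle\varphi\rangle_{form}$, and the part $\langle\rho\rangle_{env}\langle m\rangle_{mem}\langle X\rangle_{bnd}\langle\varphi\rangle_{form}$ is called an assertion. For a concrete configuration $\gamma$ and $\tau:SVar\to\mathcal T$, $(\gamma,\tau)\models\exists X((o=t)\land\varphi)$ iff there is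 $\theta:SVar\to\mathcal T$ agreeing with $\tau$ outside $X$ with $\gamma=\theta(t)$ and $\theta\models\varphi$; $\models\Gamma\Rightarrow\Gamma'$ means this implication holds for all $(\gamma,\tau)$. Proof system (derivable pairs $\Gamma\Downarrow\Gamma'$), writing $[c]\,\rho,m,X,\varphi$ for $\exists X(o=\langle c\rangle\langle\rho\rangle\langle m\rangle\land\varphi)$: M-SKIP $[skip]\rho,m,X,\varphi\Downarrow[\cdot]\rho,m,X,\varphi$; M-ASGN1 $[x:=e]\rho,m,X,\varphi\Downarrow[\cdot]\rho[\rho(e)/x],m,X,\varphi$; M-ASGN2 $[x:=A[e]]\rho,m,X,\varphi\Downarrow[\cdot]\rho[m(\rho(A)+\rho(e))/x],m,X,\varphi$; M-ASGN3 $[A[e_1]:=e_2]\rho,m,X,\varphi\Downarrow[\cdot]\rho,m[\rho(e_2)/(\rho(A)+\rho(e_1))],X,\varphi$; M-ARRAY $[A:=Array(\bar e)]\rho,m,X,\varphi\Downarrow[\cdot]\rho[p/A],(p\mapsto[\rho(\bar e)],m),X\cup\{p\},\varphi$; M-SEQ from $[c_1]\rho_1,m_1,X_1,\varphi_1\Downarrow[\cdot]\rho_2,m_2,X_2,\varphi_2$ and $[c_2]\rho_2,m_2,X_2,\varphi_2\Downarrow[\cdot]\rho_3,m_3,X_3,\varphi_3$ infer $[c_1;c_2]\rho_1,m_1,X_1,\varphi_1\Downarrow[\cdot]\rho_3,m_3,X_3,\varphi_3$; M-IF from $[c_1]\rho,m,X_1,\varphi\land\rho(b)\Downarrow\Gamma'$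 and $[c_2]\rho,m,X_1,\varphi\land\neg\rho(b)\Downarrow\Gamma'$ infer $[if(b)c_1\,else\,c_2]\rho,m,X_1,\varphi\Downarrow\Gamma'$ (where $\Gamma'$ has the form $[\cdot]\rho',m',X_2,\varphi'$); M-CONS from $\models\Gamma\Rightarrow\Gamma_1$, $\Gamma_1\Downarrow\Gamma_1'$, $\models\Gamma_1'\Rightarrow\Gamma'$ infer $\Gamma\Downarrow\Gamma'$; M-CASE from $\models\Gamma\Rightarrow\Gamma_1\lor\Gamma_2$, $\Gamma_1\Downarrow\Gamma'$, $\Gamma_2\Downarrow\Gamma'$ infer $\Gamma\Downarrow\Gamma'$; M-AWAIT from $[cc]\rho,m,X_1,\varphi\land\rho(b)\Downarrow\Gamma'$ infer $[await\;b\;then\;cc]\rho,m,X_1,\varphi\Downarrow\Gamma'$; M-WHILE from $[c]\rho,m,X,\varphi\land\rho(b)\Downarrow[\cdot]\rho,m,X,\varphi$ infer $[while\;b\;do\;c]\rho,m,X,\varphi\Downarrow[\cdot]\rho,m,X,\varphi\land\neg\rho(b)$; M-PAR from $[c_1]\rho,m,X_1,\varphi_1\Downarrow[\cdot]\rho',m',X_2,\varphi_1'$ and $[c_2]\rho,m,X_1,\varphi_2\Downarrow[\cdot]\rho',m',X_2,\varphi_2'$ with $c_1,c_2$ interference-free, infer $[c_1\parallel c_2]\rho,m,X_1,\varphi_1\land\varphi_2\Downarrow[\cdot]\rho',m',X_2,\varphi_1'\land\varphi_2'$. Here $\rho(b)$ abbreviates "$\rho(b)$ is true". Interference-freedom.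 Each derivation attaches to a computation $c$ and each of its subcomputations a precondition assertion $pre(\cdot)$ and postcondition assertion $post(\cdot)$ (a proof outline). A computation $k$ (with $pre(k)$, $post(k)$) does not interfere with $c_1$ if: (1) for every concrete $\gamma$ and $\tau$ with $(\gamma,\tau)\models\langle k\rangle_k pre(k)$ and $(\gamma,\tau)\models\langle k\rangle_k post(c_1)$, every final $\gamma'$ with $\gamma\to^*\gamma'$ satisfies $(\gamma',\tau)\models\langle\cdot\rangle_k post(c_1)$; (2) for every subcomputation $c_1'$ of $c_1$ not inside an $await$, the same holds with $pre(c_1')$ in place of $post(c_1)$. $c_1,c_2$ are interference-free if every $await$ or assignment subcomputation (not inside an $await$) of $c_1$ does not interfere with $c_2$, and vice versa. Actual execution. Given a proof outline $pre(c)\,c\,post(c)$ and $\gamma_0$ with $(\gamma_0,\tau)\models\langle c\rangle_k pre(c)$, a terminable execution $\sigma$ of $\gamma_0$ is actual if, letting $S$ be the set of computations executed in parallel with $c$ that perform the $E$-steps of $\sigma$, each $c'\in S$ and $c$ are interference-free.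
   Formalization: M-PAR also requires that its two postconditions together imply the concluded one; interference-freedom also covers end postconditions of parallel components and every M-CONS/M-CASE assertion; E-steps start where the acting command's precondition holds under τ. *)

theory Defs
  imports "HOL-Library.Finite_Map"
begin

section \<open>Syntax of PIMP\<close>

type_synonym vname = string

text \<open>
  The operators of integer and boolean expressions are arbitrary (possibly partial) operations.
  Programs have no constructor for semantic variables, so they contain none.
\<close>

datatype aexp =
    Num int
  | Var vname
  | Op "int \<Rightarrow> int \<Rightarrow> int option" aexp aexp

datatype bexp =
    BConst bool
  | Cmp "int \<Rightarrow> int \<Rightarrow> bool" aexp aexp
  | BNot bexp
  | BAnd bexp bexp

datatype com =
    Skip
  | Assign vname aexp
  | Lookup vname vname aexp       \<comment> \<open>\<open>x := A[e]\<close>\<close>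
  | Store vname aexp aexp         \<comment> \<open>\<open>A[e1] := e2\<close>\<close>
  | NewArray vname "aexp list"    \<comment> \<open>\<open>A := Array(e1, ..., en)\<close>\<close>
  | Seq com com
  | If bexp com com
  | While bexp com
  | Par com com
  | Await bexp com

fun await_body :: "com \<Rightarrow> bool" where
  "await_body (Seq c1 c2) = (await_body c1 \<and> await_body c2)"
| "await_body (If b c1 c2) = (await_body c1 \<and> await_body c2)"
| "await_body (While b c) = False"
| "await_body (Par c1 c2) = False"
| "await_body (Await b c) = False"
| "await_body _ = True"

text \<open>
  The content of the computation cell is of type \<^typ>\<open>com option\<close>, with \<^const>\<open>None\<close> for the empty
  computation; \<open>seqK\<close> and \<open>parK\<close> implement the identities that absorb it.
\<close>

fun seqK :: "com option \<Rightarrow> com \<Rightarrow> com option" where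
  "seqK None c = Some c"
| "seqK (Some c1) c = Some (Seq c1 c)"

fun parK :: "com option \<Rightarrow> com option \<Rightarrow> com option" where
  "parK None k = k"
| "parK k None = k"
| "parK (Some c1) (Some c2) = Some (Par c1 c2)"


section \<open>Operational semantics\<close>

typedef loc = "{n::nat. 0 < n}"
  by auto

type_synonym env = "(vname, int) fmap"
type_synonym mem = "(loc, int) fmap"

definition loc_of :: "int \<Rightarrow> loc option" where
  "loc_of i = (if 0 < i then Some (Abs_loc (nat i)) else None)"

fun aval :: "env \<Rightarrow> aexp \<Rightarrow> int option" where
  "aval \<rho> (Num n) = Some n"
| "aval \<rho> (Var x) = fmlookup \<rho> x"
| "aval \<rho> (Op f e1 e2) =
     Option.bind (aval \<rho> e1) (\<lambda>v1. Option.bind (aval \<rho> e2) (\<lambda>v2. f v1 v2))"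

fun bval :: "env \<Rightarrow> bexp \<Rightarrow> bool option" where
  "bval \<rho> (BConst v) = Some v"
| "bval \<rho> (Cmp f e1 e2) =
     Option.bind (aval \<rho> e1) (\<lambda>v1. Option.bind (aval \<rho> e2) (\<lambda>v2. Some (f v1 v2)))"
| "bval \<rho> (BNot b) = map_option Not (bval \<rho> b)"
| "bval \<rho> (BAnd b1 b2) =
     Option.bind (bval \<rho> b1) (\<lambda>v1. Option.bind (bval \<rho> b2) (\<lambda>v2. Some (v1 \<and> v2)))"

definition mem_lookup :: "mem \<Rightarrow> int \<Rightarrow> int option" where
  "mem_lookup m i = Option.bind (loc_of i) (fmlookup m)"

definition mem_update :: "mem \<Rightarrow> int \<Rightarrow> int \<Rightarrow> mem option" where
  "mem_update m i v = map_option (\<lambda>l. fmupd l v m) (loc_of i)"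

definition block :: "nat \<Rightarrow> int list \<Rightarrow> mem" where
  "block p vs = fmap_of_list (zip (map Abs_loc [p..<p + length vs]) vs)"

text \<open>The memory \<open>(p \<mapsto> [vs], m)\<close>: a disjoint union, undefined unless \<open>p\<close> is positive and the block is
  disjoint from \<open>m\<close>.\<close>

definition mem_alloc :: "mem \<Rightarrow> int \<Rightarrow> int list \<Rightarrow> mem option" where
  "mem_alloc m p vs =
     (if 0 < p \<and> fmdom (block (nat p) vs) |\<inter>| fmdom m = {||}
      then Some (m ++\<^sub>f block (nat p) vs) else None)"

type_synonym config = "com option \<times> env \<times> mem"

definition final :: "config \<Rightarrow> bool" where
  "final \<gamma> \<longleftrightarrow> fst \<gamma> = None"

inductive pstep :: "config \<Rightarrow> config \<Rightarrow> bool" where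
  P_Skip: "pstep (Some Skip, \<rho>, m) (None, \<rho>, m)"
| P_Assign: "aval \<rho> e = Some v \<Longrightarrow> pstep (Some (Assign x e), \<rho>, m) (None, fmupd x v \<rho>, m)"
| P_Lookup:
    "\<lbrakk> fmlookup \<rho> A = Some a; aval \<rho> e = Some i; mem_lookup m (a + i) = Some v \<rbrakk>
     \<Longrightarrow> pstep (Some (Lookup x A e), \<rho>, m) (None, fmupd x v \<rho>, m)"
| P_Store:
    "\<lbrakk> fmlookup \<rho> A = Some a; aval \<rho> e1 = Some i; aval \<rho> e2 = Some v;
       mem_update m (a + i) v = Some m' \<rbrakk>
     \<Longrightarrow> pstep (Some (Store A e1 e2), \<rho>, m) (None, \<rho>, m')"
| P_NewArray:
    "\<lbrakk> map (aval \<rho>) es = map Some vs; mem_alloc m p vs = Some m' \<rbrakk>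
     \<Longrightarrow> pstep (Some (NewArray A es), \<rho>, m) (None, fmupd A p \<rho>, m')"
| P_IfTrue: "bval \<rho> b = Some True \<Longrightarrow> pstep (Some (If b c1 c2), \<rho>, m) (Some c1, \<rho>, m)"
| P_IfFalse: "bval \<rho> b = Some False \<Longrightarrow> pstep (Some (If b c1 c2), \<rho>, m) (Some c2, \<rho>, m)"
| P_WhileTrue:
    "bval \<rho> b = Some True \<Longrightarrow> pstep (Some (While b c), \<rho>, m) (Some (Seq c (While b c)), \<rho>, m)"
| P_WhileFalse: "bval \<rho> b = Some False \<Longrightarrow> pstep (Some (While b c), \<rho>, m) (None, \<rho>, m)"
| P_Await:
    "\<lbrakk> await_body cc; bval \<rho> b = Some True; pstep\<^sup>*\<^sup>* (Some cc, \<rho>, m) (None, \<rho>', m') \<rbrakk>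
     \<Longrightarrow> pstep (Some (Await b cc), \<rho>, m) (None, \<rho>', m')"
| P_Seq:
    "pstep (Some c1, \<rho>, m) (k, \<rho>', m')
     \<Longrightarrow> pstep (Some (Seq c1 c2), \<rho>, m) (seqK k c2, \<rho>', m')"
| P_ParL:
    "pstep (Some c1, \<rho>, m) (k, \<rho>', m')
     \<Longrightarrow> pstep (Some (Par c1 c2), \<rho>, m) (parK k (Some c2), \<rho>', m')"
| P_ParR:
    "pstep (Some c2, \<rho>, m) (k, \<rho>', m')
     \<Longrightarrow> pstep (Some (Par c1 c2), \<rho>, m) (parK (Some c1) k, \<rho>', m')"

datatype label = P | E

inductive step :: "label \<Rightarrow> config \<Rightarrow> config \<Rightarrow> bool" where
  "pstep \<gamma> \<gamma>' \<Longrightarrow> step P \<gamma> \<gamma>'"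
| "step E (k, \<rho>, m) (k, \<rho>', m')"

text \<open>An execution is given by its configurations \<open>\<sigma>\<close> and the labels \<open>ls\<close> of its steps.\<close>

definition execution :: "config list \<Rightarrow> label list \<Rightarrow> bool" where
  "execution \<sigma> ls \<longleftrightarrow> length \<sigma> = Suc (length ls) \<and>
     (\<forall>i < length ls. step (ls ! i) (\<sigma> ! i) (\<sigma> ! Suc i))"

definition terminable :: "config list \<Rightarrow> label list \<Rightarrow> bool" where
  "terminable \<sigma> ls \<longleftrightarrow> execution \<sigma> ls \<and> final (last \<sigma>)"


section \<open>Matching logic patterns\<close>

text \<open>
  The model has the sorts of integers, environments and memories, and \<open>'u\<close> for the values of all
  other sorts. Function and predicate symbols are identified with their (partial) interpretations
  in the model; a predicate (in particular an equation) is false when an argument is undefined.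
\<close>

datatype sort = IntS | EnvS | MemS | OtherS

datatype 'u val = VInt int | VEnv env | VMem mem | VOther 'u

fun sort_of :: "'u val \<Rightarrow> sort" where
  "sort_of (VInt _) = IntS"
| "sort_of (VEnv _) = EnvS"
| "sort_of (VMem _) = MemS"
| "sort_of (VOther _) = OtherS"

type_synonym svar = "sort \<times> nat"

definition valuation :: "(svar \<Rightarrow> 'u val) \<Rightarrow> bool" where
  "valuation \<tau> \<longleftrightarrow> (\<forall>x. sort_of (\<tau> x) = fst x)"

datatype 'u trm =
    SVar svar
  | Fn "'u val list \<Rightarrow> 'u val option" "'u trm list"

datatype 'u form =
    Pred "'u val list \<Rightarrow> bool" "'u trm list"
  | Neg "'u form"
  | Conj "'u form" "'u form"
  | Ex svar "'u form"

primrec teval :: "(svar \<Rightarrow> 'u val) \<Rightarrow> 'u trm \<Rightarrow> 'u val option" where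
  "teval \<theta> (SVar x) = Some (\<theta> x)"
| "teval \<theta> (Fn f ts) = Option.bind (those (map (teval \<theta>) ts)) f"

primrec fsat :: "(svar \<Rightarrow> 'u val) \<Rightarrow> 'u form \<Rightarrow> bool" where
  "fsat \<theta> (Pred p ts) = (\<exists>vs. those (map (teval \<theta>) ts) = Some vs \<and> p vs)"
| "fsat \<theta> (Neg \<phi>) = (\<not> fsat \<theta> \<phi>)"
| "fsat \<theta> (Conj \<phi> \<psi>) = (fsat \<theta> \<phi> \<and> fsat \<theta> \<psi>)"
| "fsat \<theta> (Ex x \<phi>) = (\<exists>v. sort_of v = fst x \<and> fsat (\<theta>(x := v)) \<phi>)"

primrec tvars :: "'u trm \<Rightarrow> svar set" where
  "tvars (SVar x) = {x}"
| "tvars (Fn f ts) = \<Union> (set (map tvars ts))"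

primrec fvars :: "'u form \<Rightarrow> svar set" where
  "fvars (Pred p ts) = \<Union> (set (map tvars ts))"
| "fvars (Neg \<phi>) = fvars \<phi>"
| "fvars (Conj \<phi> \<psi>) = fvars \<phi> \<union> fvars \<psi>"
| "fvars (Ex x \<phi>) = fvars \<phi> - {x}"

text \<open>An assertion consists of the environment, memory, bnd and form cells.\<close>

type_synonym 'u assertion = "'u trm \<times> 'u trm \<times> svar set \<times> 'u form"
type_synonym 'u pattern = "com option \<times> 'u assertion"

fun sat :: "config \<Rightarrow> (svar \<Rightarrow> 'u val) \<Rightarrow> 'u pattern \<Rightarrow> bool" where
  "sat (k', \<rho>', m') \<tau> (k, \<rho>, m, X, \<phi>) \<longleftrightarrow> k' = k \<and>
     (\<exists>\<theta>. valuation \<theta> \<and> (\<forall>x. x \<notin> X \<longrightarrow> \<theta> x = \<tau> x) \<and>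
          teval \<theta> \<rho> = Some (VEnv \<rho>') \<and> teval \<theta> m = Some (VMem m') \<and> fsat \<theta> \<phi>)"

definition entails :: "'u pattern \<Rightarrow> 'u pattern \<Rightarrow> bool" where
  "entails \<Gamma> \<Gamma>' \<longleftrightarrow> (\<forall>\<gamma> \<tau>. valuation \<tau> \<longrightarrow> sat \<gamma> \<tau> \<Gamma> \<longrightarrow> sat \<gamma> \<tau> \<Gamma>')"

definition entails_disj :: "'u pattern \<Rightarrow> 'u pattern \<Rightarrow> 'u pattern \<Rightarrow> bool" where
  "entails_disj \<Gamma> \<Gamma>1 \<Gamma>2 \<longleftrightarrow>
     (\<forall>\<gamma> \<tau>. valuation \<tau> \<longrightarrow> sat \<gamma> \<tau> \<Gamma> \<longrightarrow> sat \<gamma> \<tau> \<Gamma>1 \<or> sat \<gamma> \<tau> \<Gamma>2)"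

definition conj_entails :: "'u pattern \<Rightarrow> 'u pattern \<Rightarrow> 'u pattern \<Rightarrow> bool" where
  "conj_entails \<Gamma>1 \<Gamma>2 \<Gamma> \<longleftrightarrow>
     (\<forall>\<gamma> \<tau>. valuation \<tau> \<longrightarrow> sat \<gamma> \<tau> \<Gamma>1 \<and> sat \<gamma> \<tau> \<Gamma>2 \<longrightarrow> sat \<gamma> \<tau> \<Gamma>)"


subsection \<open>Symbols occurring in the proof rules\<close>

fun aval_fn :: "aexp \<Rightarrow> 'u val list \<Rightarrow> 'u val option" where
  "aval_fn e [VEnv \<rho>] = map_option VInt (aval \<rho> e)"
| "aval_fn e _ = None"

fun bval_fn :: "bexp \<Rightarrow> 'u val list \<Rightarrow> bool" where
  "bval_fn b [VEnv \<rho>] = (bval \<rho> b = Some True)"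
| "bval_fn b _ = False"

fun plus_fn :: "'u val list \<Rightarrow> 'u val option" where
  "plus_fn [VInt i, VInt j] = Some (VInt (i + j))"
| "plus_fn _ = None"

fun env_update_fn :: "vname \<Rightarrow> 'u val list \<Rightarrow> 'u val option" where
  "env_update_fn x [VEnv \<rho>, VInt v] = Some (VEnv (fmupd x v \<rho>))"
| "env_update_fn x _ = None"

fun mem_lookup_fn :: "'u val list \<Rightarrow> 'u val option" where
  "mem_lookup_fn [VMem m, VInt i] = map_option VInt (mem_lookup m i)"
| "mem_lookup_fn _ = None"

fun mem_update_fn :: "'u val list \<Rightarrow> 'u val option" where
  "mem_update_fn [VMem m, VInt i, VInt v] = map_option VMem (mem_update m i v)"
| "mem_update_fn _ = None"

fun the_int :: "'u val \<Rightarrow> int option" where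
  "the_int (VInt i) = Some i"
| "the_int _ = None"

fun mem_alloc_fn :: "'u val list \<Rightarrow> 'u val option" where
  "mem_alloc_fn (VMem m # VInt p # vs) =
     Option.bind (those (map the_int vs)) (\<lambda>is. map_option VMem (mem_alloc m p is))"
| "mem_alloc_fn _ = None"

abbreviation tA :: "'u trm \<Rightarrow> aexp \<Rightarrow> 'u trm" where    \<comment> \<open>\<open>\<rho>(e)\<close>\<close>
  "tA \<rho> e \<equiv> Fn (aval_fn e) [\<rho>]"

abbreviation tB :: "'u trm \<Rightarrow> bexp \<Rightarrow> 'u form" where    \<comment> \<open>\<open>\<rho>(b)\<close> is true\<close>
  "tB \<rho> b \<equiv> Pred (bval_fn b) [\<rho>]"

abbreviation tAddr :: "'u trm \<Rightarrow> vname \<Rightarrow> aexp \<Rightarrow> 'u trm" where    \<comment> \<open>\<open>\<rho>(A) + \<rho>(e)\<close>\<close>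
  "tAddr \<rho> A e \<equiv> Fn plus_fn [tA \<rho> (Var A), tA \<rho> e]"

abbreviation tEnvUpd :: "'u trm \<Rightarrow> vname \<Rightarrow> 'u trm \<Rightarrow> 'u trm" where
  "tEnvUpd \<rho> x t \<equiv> Fn (env_update_fn x) [\<rho>, t]"

abbreviation tMemLookup :: "'u trm \<Rightarrow> 'u trm \<Rightarrow> 'u trm" where
  "tMemLookup m t \<equiv> Fn mem_lookup_fn [m, t]"

abbreviation tMemUpd :: "'u trm \<Rightarrow> 'u trm \<Rightarrow> 'u trm \<Rightarrow> 'u trm" where
  "tMemUpd m l t \<equiv> Fn mem_update_fn [m, l, t]"

abbreviation tMemAlloc :: "'u trm \<Rightarrow> 'u trm \<Rightarrow> 'u trm list \<Rightarrow> 'u trm" where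
  "tMemAlloc m p ts \<equiv> Fn mem_alloc_fn (m # p # ts)"


section \<open>Proof outlines and interference-freedom\<close>

text \<open>
  A proof outline lists the triples (computation, precondition, postcondition) attached to a
  computation and its subcomputations outside of awaits. The consequence and case rules attach
  further assertions to a computation that already carries some; the outline keeps all of them.
\<close>

type_synonym 'u outline = "(com option \<times> 'u assertion \<times> 'u assertion) set"

definition attach :: "'u pattern \<Rightarrow> 'u pattern \<Rightarrow> com option \<times> 'u assertion \<times> 'u assertion" where
  "attach \<Gamma> \<Gamma>' = (fst \<Gamma>, snd \<Gamma>, snd \<Gamma>')"

text \<open>
  A component of a parallel composition that has finished leaves the empty computation behind,
  whose precondition is the postcondition of the component. If these assertions were not part of
  the outline, a third process could invalidate the postcondition of a component of a nested
  parallel composition between the termination of that component and that of its sibling.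
\<close>

definition component_end :: "'u pattern \<Rightarrow> com option \<times> 'u assertion \<times> 'u assertion" where
  "component_end \<Gamma>' = (None, snd \<Gamma>', snd \<Gamma>')"

fun atomic :: "com \<Rightarrow> bool" where
  "atomic (Assign x e) = True"
| "atomic (Lookup x A e) = True"
| "atomic (Store A e1 e2) = True"
| "atomic (NewArray A es) = True"
| "atomic (Await b cc) = True"
| "atomic _ = False"

definition preserves :: "com \<Rightarrow> 'u assertion \<Rightarrow> 'u assertion \<Rightarrow> bool" where
  "preserves k pre_k a \<longleftrightarrow>
     (\<forall>\<gamma> \<gamma>' \<tau>. valuation \<tau> \<longrightarrow> sat \<gamma> \<tau> (Some k, pre_k) \<longrightarrow> sat \<gamma> \<tau> (Some k, a) \<longrightarrow>
        pstep\<^sup>*\<^sup>* \<gamma> \<gamma>' \<longrightarrow> final \<gamma>' \<longrightarrow> sat \<gamma>' \<tau> (None, a))"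

text \<open>Below, \<open>\<Delta>\<close> is the outline of a computation and \<open>\<Gamma>'\<close> the pattern with its postcondition.\<close>

definition not_interfering :: "com \<Rightarrow> 'u assertion \<Rightarrow> 'u outline \<Rightarrow> 'u pattern \<Rightarrow> bool" where
  "not_interfering k pre_k \<Delta> \<Gamma>' \<longleftrightarrow>
     preserves k pre_k (snd \<Gamma>') \<and> (\<forall>(c, pre, post) \<in> \<Delta>. preserves k pre_k pre)"

definition interference_free ::
    "'u outline \<Rightarrow> 'u pattern \<Rightarrow> 'u outline \<Rightarrow> 'u pattern \<Rightarrow> bool" where
  "interference_free \<Delta>1 \<Gamma>1' \<Delta>2 \<Gamma>2' \<longleftrightarrow>
     (\<forall>k pre post. (Some k, pre, post) \<in> \<Delta>1 \<and> atomic k \<longrightarrow> not_interfering k pre \<Delta>2 \<Gamma>2') \<and>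
     (\<forall>k pre post. (Some k, pre, post) \<in> \<Delta>2 \<and> atomic k \<longrightarrow> not_interfering k pre \<Delta>1 \<Gamma>1')"


section \<open>The proof system\<close>

text \<open>
  \<open>derives \<Delta> \<Gamma> \<Gamma>'\<close>: there is a derivation of the correctness pair of \<open>\<Gamma>\<close> and \<open>\<Gamma>'\<close> that attaches the
  proof outline \<open>\<Delta>\<close>.

  The side condition \<^const>\<open>conj_entails\<close> of \<open>M_Par\<close> says that the pattern with \<open>\<phi>1' \<and> \<phi>2'\<close>
  expresses the conjunction of the two postconditions. It can fail because the two postconditions
  may need different witnesses for the variables in \<open>X2\<close>; without it, \<open>skip \<parallel> skip\<close> would have the
  derivable postcondition \<open>a = 1 \<and> a = 2\<close> with \<open>a\<close> bound, so the rule would be unsound.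
\<close>

inductive derives :: "'u outline \<Rightarrow> 'u pattern \<Rightarrow> 'u pattern \<Rightarrow> bool" where
  M_Skip:
    "\<lbrakk> \<Gamma> = (Some Skip, \<rho>, m, X, \<phi>);
       \<Gamma>' = (None, \<rho>, m, X, \<phi>) \<rbrakk>
     \<Longrightarrow> derives {attach \<Gamma> \<Gamma>'} \<Gamma> \<Gamma>'"
| M_Asgn1:
    "\<lbrakk> \<Gamma> = (Some (Assign x e), \<rho>, m, X, \<phi>);
       \<Gamma>' = (None, tEnvUpd \<rho> x (tA \<rho> e), m, X, \<phi>) \<rbrakk>
     \<Longrightarrow> derives {attach \<Gamma> \<Gamma>'} \<Gamma> \<Gamma>'"
| M_Asgn2:
    "\<lbrakk> \<Gamma> = (Some (Lookup x A e), \<rho>, m, X, \<phi>);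
       \<Gamma>' = (None, tEnvUpd \<rho> x (tMemLookup m (tAddr \<rho> A e)), m, X, \<phi>) \<rbrakk>
     \<Longrightarrow> derives {attach \<Gamma> \<Gamma>'} \<Gamma> \<Gamma>'"
| M_Asgn3:
    "\<lbrakk> \<Gamma> = (Some (Store A e1 e2), \<rho>, m, X, \<phi>);
       \<Gamma>' = (None, \<rho>, tMemUpd m (tAddr \<rho> A e1) (tA \<rho> e2), X, \<phi>) \<rbrakk>
     \<Longrightarrow> derives {attach \<Gamma> \<Gamma>'} \<Gamma> \<Gamma>'"
| M_Array:
    "\<lbrakk> fst p = IntS; p \<notin> X \<union> tvars \<rho> \<union> tvars m \<union> fvars \<phi>;
       \<Gamma> = (Some (NewArray A es), \<rho>, m, X, \<phi>);
       \<Gamma>' = (None, tEnvUpd \<rho> A (SVar p), tMemAlloc m (SVar p) (map (tA \<rho>) es), X \<union> {p}, \<phi>) \<rbrakk>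
     \<Longrightarrow> derives {attach \<Gamma> \<Gamma>'} \<Gamma> \<Gamma>'"
| M_Seq:
    "\<lbrakk> derives \<Delta>1 (Some c1, \<rho>1, m1, X1, \<phi>1) (None, \<rho>2, m2, X2, \<phi>2);
       derives \<Delta>2 (Some c2, \<rho>2, m2, X2, \<phi>2) (None, \<rho>3, m3, X3, \<phi>3);
       \<Gamma> = (Some (Seq c1 c2), \<rho>1, m1, X1, \<phi>1);
       \<Gamma>' = (None, \<rho>3, m3, X3, \<phi>3) \<rbrakk>
     \<Longrightarrow> derives (insert (attach \<Gamma> \<Gamma>') (\<Delta>1 \<union> \<Delta>2)) \<Gamma> \<Gamma>'"
| M_If:
    "\<lbrakk> derives \<Delta>1 (Some c1, \<rho>, m, X1, Conj \<phi> (tB \<rho> b)) \<Gamma>';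
       derives \<Delta>2 (Some c2, \<rho>, m, X1, Conj \<phi> (Neg (tB \<rho> b))) \<Gamma>';
       \<Gamma> = (Some (If b c1 c2), \<rho>, m, X1, \<phi>);
       \<Gamma>' = (None, \<rho>', m', X2, \<phi>') \<rbrakk>
     \<Longrightarrow> derives (insert (attach \<Gamma> \<Gamma>') (\<Delta>1 \<union> \<Delta>2)) \<Gamma> \<Gamma>'"
| M_Cons:
    "\<lbrakk> entails \<Gamma> \<Gamma>1; derives \<Delta> \<Gamma>1 \<Gamma>1'; entails \<Gamma>1' \<Gamma>' \<rbrakk>
     \<Longrightarrow> derives (insert (attach \<Gamma> \<Gamma>') \<Delta>) \<Gamma> \<Gamma>'"
| M_Case:
    "\<lbrakk> entails_disj \<Gamma> \<Gamma>1 \<Gamma>2; derives \<Delta>1 \<Gamma>1 \<Gamma>'; derives \<Delta>2 \<Gamma>2 \<Gamma>' \<rbrakk>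
     \<Longrightarrow> derives (insert (attach \<Gamma> \<Gamma>') (\<Delta>1 \<union> \<Delta>2)) \<Gamma> \<Gamma>'"
| M_Await:
    "\<lbrakk> await_body cc;
       derives \<Delta> (Some cc, \<rho>, m, X1, Conj \<phi> (tB \<rho> b)) \<Gamma>';
       \<Gamma> = (Some (Await b cc), \<rho>, m, X1, \<phi>) \<rbrakk>
     \<Longrightarrow> derives {attach \<Gamma> \<Gamma>'} \<Gamma> \<Gamma>'"
| M_While:
    "\<lbrakk> derives \<Delta> (Some c, \<rho>, m, X, Conj \<phi> (tB \<rho> b)) (None, \<rho>, m, X, \<phi>);
       \<Gamma> = (Some (While b c), \<rho>, m, X, \<phi>);
       \<Gamma>' = (None, \<rho>, m, X, Conj \<phi> (Neg (tB \<rho> b))) \<rbrakk>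
     \<Longrightarrow> derives (insert (attach \<Gamma> \<Gamma>') \<Delta>) \<Gamma> \<Gamma>'"
| M_Par:
    "\<lbrakk> \<Gamma>1' = (None, \<rho>', m', X2, \<phi>1');
       \<Gamma>2' = (None, \<rho>', m', X2, \<phi>2');
       derives \<Delta>1 (Some c1, \<rho>, m, X1, \<phi>1) \<Gamma>1';
       derives \<Delta>2 (Some c2, \<rho>, m, X1, \<phi>2) \<Gamma>2';
       interference_free \<Delta>1 \<Gamma>1' \<Delta>2 \<Gamma>2';
       \<Gamma> = (Some (Par c1 c2), \<rho>, m, X1, Conj \<phi>1 \<phi>2);
       \<Gamma>' = (None, \<rho>', m', X2, Conj \<phi>1' \<phi>2');
       conj_entails \<Gamma>1' \<Gamma>2' \<Gamma>' \<rbrakk>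
     \<Longrightarrow> derives (insert (attach \<Gamma> \<Gamma>')
           ({component_end \<Gamma>1', component_end \<Gamma>2'} \<union> \<Delta>1 \<union> \<Delta>2)) \<Gamma> \<Gamma>'"


section \<open>Actual executions\<close>

text \<open>
  \<open>S\<close> is a set of computations, each given by a derivation \<open>(\<Delta>, \<Gamma>, \<Gamma>')\<close>. An E-step is performed by
  \<open>S\<close> if it is a step of an assignment or await that belongs to a member of \<open>S\<close>, taken in a state
  satisfying the precondition which the outline of that member attaches to it (under the same
  valuation), or if it leaves environment and memory unchanged, as do the steps of \<open>skip\<close> and the
  evaluation of conditions. Interference-freedom says nothing about steps from states outside that
  precondition, which contradict the proof outline of the member.
\<close>

fun performed_by ::
    "('u outline \<times> 'u pattern \<times> 'u pattern) set \<Rightarrow> (svar \<Rightarrow> 'u val) \<Rightarrow> config \<Rightarrow> config \<Rightarrow> bool" where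
  "performed_by S \<tau> (c, \<rho>, m) (c', \<rho>', m') \<longleftrightarrow>
     (\<rho>' = \<rho> \<and> m' = m) \<or>
     (\<exists>(\<Delta>, \<Gamma>, \<Gamma>') \<in> S. \<exists>k pre post. (Some k, pre, post) \<in> \<Delta> \<and> atomic k \<and>
        sat (Some k, \<rho>, m) \<tau> (Some k, pre) \<and> pstep (Some k, \<rho>, m) (None, \<rho>', m'))"

definition actual ::
    "'u outline \<Rightarrow> 'u pattern \<Rightarrow> 'u pattern \<Rightarrow> (svar \<Rightarrow> 'u val) \<Rightarrow> config list \<Rightarrow> label list \<Rightarrow> bool" where
  "actual \<Delta> \<Gamma> \<Gamma>' \<tau> \<sigma> ls \<longleftrightarrow>
     sat (hd \<sigma>) \<tau> \<Gamma> \<and> terminable \<sigma> ls \<and>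
     (\<exists>S. (\<forall>(\<Delta>1, \<Gamma>1, \<Gamma>1') \<in> S. derives \<Delta>1 \<Gamma>1 \<Gamma>1' \<and> interference_free \<Delta>1 \<Gamma>1' \<Delta> \<Gamma>') \<and>
          (\<forall>i < length ls. ls ! i = E \<longrightarrow> performed_by S \<tau> (\<sigma> ! i) (\<sigma> ! Suc i)))"

end

theory Submission
  imports Defs
begin

text \<open>
  Following Owicki and Gries, a proof outline is read as a rely-guarantee specification: the rely
  says that every precondition of the outline is preserved, the guarantee that each program step
  either leaves the state unchanged or is a step of an atomic command from its precondition.
  Interference-freedom of two outlines says precisely that the guarantee of each implies the rely of
  the other. Hence by induction on the derivation every derivable pair yields a computation that is
  safe for the specification of its outline, and an actual execution only makes E-steps that respect
  the rely.
\<close>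

section \<open>Safe computations\<close>

text \<open>
  A finished computation is not asked to be stable under the rely: the consequence rule drops the old
  postcondition from what the environment has to preserve. Stability of the postcondition is imposed
  only where two processes meet (\<open>safe_env\<close>, \<open>safe_par\<close>).
\<close>

coinductive safe ::
    "(env \<times> mem \<Rightarrow> env \<times> mem \<Rightarrow> bool) \<Rightarrow> (env \<times> mem \<Rightarrow> env \<times> mem \<Rightarrow> bool) \<Rightarrow>
     (env \<times> mem \<Rightarrow> bool) \<Rightarrow> com option \<Rightarrow> env \<times> mem \<Rightarrow> bool"
  for R G Q where
  Done: "Q s \<Longrightarrow> safe R G Q None s"
| Run: "\<lbrakk> \<And>s'. R s s' \<Longrightarrow> safe R G Q (Some c) s';
          \<And>k s'. pstep (Some c, s) (k, s') \<Longrightarrow> G s s' \<and> safe R G Q k s' \<rbrakk>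
        \<Longrightarrow> safe R G Q (Some c) s"

section \<open>Elementary properties of safety\<close>

lemma safe_None [simp]: "safe R G Q None s \<longleftrightarrow> Q s"
  by (auto intro: Done elim: safe.cases)

lemma safe_rely: "safe R G Q (Some c) s \<Longrightarrow> R s s' \<Longrightarrow> safe R G Q (Some c) s'"
  by (erule safe.cases) auto

lemma safe_pstep:
  "safe R G Q (Some c) s \<Longrightarrow> pstep (Some c, s) (k, s') \<Longrightarrow> G s s' \<and> safe R G Q k s'"
  by (erule safe.cases) auto

inductive_cases pstep_SkipE: "pstep (Some Skip, s) (k, s')"
inductive_cases pstep_AssignE: "pstep (Some (Assign x e), s) (k, s')"
inductive_cases pstep_LookupE: "pstep (Some (Lookup x A e), s) (k, s')"
inductive_cases pstep_StoreE: "pstep (Some (Store A e1 e2), s) (k, s')"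
inductive_cases pstep_NewArrayE: "pstep (Some (NewArray A es), s) (k, s')"
inductive_cases pstep_IfE: "pstep (Some (If b c1 c2), s) (k, s')"
inductive_cases pstep_WhileE: "pstep (Some (While b c), s) (k, s')"
inductive_cases pstep_AwaitE: "pstep (Some (Await b c), s) (k, s')"
inductive_cases pstep_SeqE: "pstep (Some (Seq c1 c2), s) (k, s')"
inductive_cases pstep_ParE: "pstep (Some (Par c1 c2), s) (k, s')"
inductive_cases pstep_NoneE: "pstep (None, s) \<gamma>"

text \<open>For \<open>k = None\<close>, \<open>safe\<close> says nothing about the rely, so
  stability of \<open>Q\<close> enters as a premise of its own.\<close>

lemma safe_env:
  assumes "safe R G Q k s" "R s s'" "Q s \<Longrightarrow> Q s'"
  shows "safe R G Q k s'"
  using assms by (cases k) (auto intro: safe_rely)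

text \<open>This covers the uninterrupted run of an await body as well as a single program step of
  an execution.\<close>

lemma safe_steps:
  assumes "pstep\<^sup>*\<^sup>* (k, s) (k', s')" "safe R G Q k s"
  shows "safe R G Q k' s'"
  using assms
proof (induction "(k, s)" arbitrary: k s rule: converse_rtranclp_induct)
  case (step \<gamma>)
  then show ?case
    by (cases \<gamma>; cases k) (auto elim: pstep_NoneE dest: safe_pstep)
qed

lemma safe_mono:
  assumes "safe R G Q k s"
    and "\<And>s s'. R' s s' \<Longrightarrow> R s s'" "\<And>s s'. G s s' \<Longrightarrow> G' s s'" "\<And>s. Q s \<Longrightarrow> Q' s"
  shows "safe R' G' Q' k s"
  using assms(1)
proof (coinduction arbitrary: k s)
  case safe
  show ?case
  proof (cases k)
    case None
    then show ?thesis using safe assms(4) by simp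
  next
    case (Some c)
    have "safe R G Q (Some c) s'" if "R' s s'" for s'
      using safe Some assms(2) that by (blast dest: safe_rely)
    moreover have "G' s s' \<and> safe R G Q k' s'" if "pstep (Some c, s) (k', s')" for k' s'
      using safe Some assms(3) that by (blast dest: safe_pstep)
    ultimately show ?thesis
      using Some by blast
  qed
qed

section \<open>Safety of commands and of their compositions\<close>

lemma safe_invariant:
  assumes "I s"
    and "\<And>s s'. I s \<Longrightarrow> R s s' \<Longrightarrow> I s'"
    and "\<And>s k s'. I s \<Longrightarrow> pstep (Some c, s) (k, s') \<Longrightarrow> G s s' \<and> safe R G Q k s'"
  shows "safe R G Q (Some c) s"
  \<comment> \<open>The states satisfying \<open>I\<close> form the coinduction set; environment
    steps stay in it, and program steps lead to configurations already known to be safe.\<close>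
  using assms(1) by (coinduction arbitrary: s) (use assms(2,3) in blast)

text \<open>The handover is immediate: \<open>seqK\<close> absorbs the finished first component, so
  \<open>c\<close> is current in the very state that satisfies \<open>I\<close>, and later
  interference is covered by the safety of \<open>c\<close>.\<close>

lemma safe_seq:
  assumes "safe R G I k s" and "\<And>s. I s \<Longrightarrow> safe R G Q (Some c) s"
  shows "safe R G Q (seqK k c) s"
  using assms(1)
proof (coinduction arbitrary: k s)
  case safe
  show ?case
  proof (cases k)
    case None
    then have "safe R G Q (Some c) s"
      using safe assms(2) by simp
    then show ?thesis
      using None by (auto dest: safe_rely safe_pstep)
  next
    case (Some c1)
    have "\<exists>k1. seqK k c = seqK k1 c \<and> safe R G I k1 s'" if "R s s'" for s'
      using safe Some that by (blast dest: safe_rely)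
    moreover have "G s s' \<and> (\<exists>k1. k' = seqK k1 c \<and> safe R G I k1 s')"
      if "pstep (Some (Seq c1 c), s) (k', s')" for k' s'
      using that safe Some by (cases s) (auto elim!: pstep_SeqE dest: safe_pstep)
    ultimately show ?thesis
      using Some by fastforce
  qed
qed

text \<open>The invariant is stable under the rely because interference can occur at the loop head,
  and \<open>G\<close> is reflexive because evaluating the condition is a step that keeps the
  state.\<close>

lemma safe_while:
  assumes "I s"
    and I_stable: "\<And>s s'. I s \<Longrightarrow> R s s' \<Longrightarrow> I s'" and "\<And>s. G s s"
    and body: "\<And>s. I s \<Longrightarrow> bval (fst s) b = Some True \<Longrightarrow> safe R G I (Some c) s"
    and "\<And>s. I s \<Longrightarrow> bval (fst s) b \<noteq> Some True \<Longrightarrow> Q s"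
  shows "safe R G Q (Some (While b c)) s"
proof -
  define W where "W = While b c"
  have W_step: "G s s' \<and> (k' = None \<and> Q s' \<or> k' = seqK (Some c) W \<and> safe R G I (Some c) s')"
    if "I s" "pstep (Some W, s) (k', s')" for s k' s'
    using that(2,1) assms(3,5) body[of s] unfolding W_def
    by (cases s) (auto elim!: pstep_WhileE)
  \<comment> \<open>While the loop runs, the computation has the form \<open>seqK k W\<close>, where
    \<open>k\<close> is what remains of the current iteration; \<open>k = None\<close> is the loop
    head.\<close>
  have "safe R G Q (seqK k W) s" if "safe R G I k s" for k s
    using that
  proof (coinduction arbitrary: k s)
    case safe
    show ?case
    proof (cases k)
      case None
      have "\<exists>k. Some W = seqK k W \<and> safe R G I k s'" if "R s s'" for s'
        using I_stable[OF _ that] safe None by (intro exI[of _ None]) simp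
      moreover have "G s s' \<and> ((\<exists>k. k' = seqK k W \<and> safe R G I k s') \<or> safe R G Q k' s')"
        if "pstep (Some W, s) (k', s')" for k' s'
        using W_step[OF _ that] safe None by (metis safe_None)
      ultimately show ?thesis
        using None by fastforce
    next
      case (Some c1)
      have "\<exists>k1. seqK k W = seqK k1 W \<and> safe R G I k1 s'" if "R s s'" for s'
        using safe Some that by (blast dest: safe_rely)
      moreover have "G s s' \<and> (\<exists>k1. k' = seqK k1 W \<and> safe R G I k1 s')"
        if "pstep (Some (Seq c1 W), s) (k', s')" for k' s'
        using that safe Some by (cases s) (auto elim!: pstep_SeqE dest: safe_pstep)
      ultimately show ?thesis
        using Some by fastforce
    qed
  qed
  from this[of None s] show ?thesis
    using \<open>I s\<close> by (simp add: W_def)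
qed

text \<open>A step of one component is interference for the other, so each guarantee implies the
  other rely. It also preserves the other postcondition, because a component may finish before its
  sibling.\<close>

lemma safe_par:
  assumes "safe R1 G1 Q1 k1 s" "safe R2 G2 Q2 k2 s"
    and G1: "\<And>s s'. G1 s s' \<Longrightarrow> G s s' \<and> R2 s s' \<and> (Q2 s \<longrightarrow> Q2 s')"
    and G2: "\<And>s s'. G2 s s' \<Longrightarrow> G s s' \<and> R1 s s' \<and> (Q1 s \<longrightarrow> Q1 s')"
    and R: "\<And>s s'. R s s' \<Longrightarrow> R1 s s' \<and> R2 s s' \<and> (Q1 s \<longrightarrow> Q1 s') \<and> (Q2 s \<longrightarrow> Q2 s')"
    and Q: "\<And>s. Q1 s \<Longrightarrow> Q2 s \<Longrightarrow> Q s"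
  shows "safe R G Q (parK k1 k2) s"
  using assms(1,2)
proof (coinduction arbitrary: k1 k2 s)
  case safe
  note env1 = safe_env[OF safe(1)] and env2 = safe_env[OF safe(2)]
  let ?X = "\<lambda>k s. \<exists>k1 k2. k = parK k1 k2 \<and> safe R1 G1 Q1 k1 s \<and> safe R2 G2 Q2 k2 s"
  have rely: "?X (parK k1 k2) s'" if "R s s'" for s'
    using R[OF that] env1 env2 by blast
  have left: "G s s' \<and> ?X (parK k k2) s'" if "k1 = Some c" "pstep (Some c, s) (k, s')" for c k s'
    using safe_pstep[OF safe(1)[unfolded that(1)] that(2)] G1 env2 by blast
  have right: "G s s' \<and> ?X (parK k1 k) s'" if "k2 = Some c" "pstep (Some c, s) (k, s')" for c k s'
    using safe_pstep[OF safe(2)[unfolded that(1)] that(2)] G2 env1 by blast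
  \<comment> \<open>\<open>parK\<close> drops a finished component, in which case every step is a
    step of the one that remains.\<close>
  have step: "G s s' \<and> ?X k s'" if "parK k1 k2 = Some c" "pstep (Some c, s) (k, s')" for c k s'
  proof (cases k1)
    case None
    then show ?thesis using that right[of c k s'] by simp
  next
    case k1: (Some c1)
    show ?thesis
    proof (cases k2)
      case None
      then show ?thesis using k1 that left[of c k s'] by (cases k) simp_all
    next
      case (Some c2)
      then have "pstep (Some (Par c1 c2), s) (k, s')"
        using k1 that by simp
      then show ?thesis
        by (rule pstep_ParE) (use k1 Some left right in auto)
    qed
  qed
  show ?case
  proof (cases "parK k1 k2")
    case None
    then have "k1 = None" "k2 = None"
      by (cases k1; cases k2; simp)+
    then show ?thesis using safe Q by simp
  next
    case (Some c)
    then show ?thesis using rely step by (metis (no_types, lifting))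
  qed
qed


section \<open>Patterns\<close>

text \<open>Empty computation cells on both sides turn an assertion into a predicate on
  states.\<close>

abbreviation holds :: "(svar \<Rightarrow> 'u val) \<Rightarrow> 'u assertion \<Rightarrow> env \<times> mem \<Rightarrow> bool" where
  "holds \<tau> a s \<equiv> sat (None, s) \<tau> (None, a)"

text \<open>Programs contain no semantic variables, so the computation cell is compared literally,
  independently of the witness \<theta>.\<close>

lemma sat_iff_holds: "sat (k, s) \<tau> \<Gamma> \<longleftrightarrow> k = fst \<Gamma> \<and> holds \<tau> (snd \<Gamma>) s"
  by (cases \<Gamma>; cases s) auto

text \<open>The conjunct moves out of the existential over witnesses because its truth is fixed by
  the environment that \<open>r\<close> denotes.\<close>

lemma holds_Conj:
  assumes "\<And>\<theta>. teval \<theta> r = Some (VEnv (fst s)) \<Longrightarrow> fsat \<theta> \<psi> \<longleftrightarrow> B"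
  shows "holds \<tau> (r, m, X, Conj \<phi> \<psi>) s \<longleftrightarrow> holds \<tau> (r, m, X, \<phi>) s \<and> B"
proof -
  obtain \<rho> \<mu> where s: "s = (\<rho>, \<mu>)" by fastforce
  show ?thesis
    using assms unfolding s sat.simps fsat.simps(3) fst_conv by blast
qed

lemma holds_Conj_tB:
  "holds \<tau> (r, m, X, Conj \<phi> (tB r b)) s \<longleftrightarrow>
     holds \<tau> (r, m, X, \<phi>) s \<and> bval (fst s) b = Some True"
  by (rule holds_Conj) simp

text \<open>The condition is \<open>\<noteq> Some True\<close> and not \<open>= Some False\<close>:
  the negated atom also admits an undefined condition, on which \<open>If\<close> and
  \<open>While\<close> have no step.\<close>

lemma holds_Conj_Neg_tB:
  "holds \<tau> (r, m, X, Conj \<phi> (Neg (tB r b))) s \<longleftrightarrow>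
     holds \<tau> (r, m, X, \<phi>) s \<and> bval (fst s) b \<noteq> Some True"
  by (rule holds_Conj) simp

section \<open>Dependence of terms and formulas on their free variables\<close>

lemma teval_cong: "(\<And>x. x \<in> tvars t \<Longrightarrow> \<theta> x = \<theta>' x) \<Longrightarrow> teval \<theta> t = teval \<theta>' t"
proof (induction t)
  case (Fn f ts)
  then have "map (teval \<theta>) ts = map (teval \<theta>') ts"
    by (fastforce intro: map_cong)
  then show ?case by (simp only: teval.simps)
qed simp

lemma fsat_cong: "(\<And>x. x \<in> fvars \<phi> \<Longrightarrow> \<theta> x = \<theta>' x) \<Longrightarrow> fsat \<theta> \<phi> = fsat \<theta>' \<phi>"
proof (induction \<phi> arbitrary: \<theta> \<theta>')
  case (Pred p ts)
  have "teval \<theta> t = teval \<theta>' t" if "t \<in> set ts" for t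
    using that Pred by (intro teval_cong) auto
  then have "map (teval \<theta>) ts = map (teval \<theta>') ts"
    by (rule map_cong[OF refl])
  then show ?case by (simp only: fsat.simps)
next
  case (Neg \<phi>)
  from Neg.IH[of \<theta> \<theta>'] Neg.prems show ?case by simp
next
  case (Conj \<phi> \<psi>)
  from Conj.IH(1)[of \<theta> \<theta>'] Conj.IH(2)[of \<theta> \<theta>'] Conj.prems show ?case by simp
next
  case (Ex x \<phi>)
  have "fsat (\<theta>(x := v)) \<phi> = fsat (\<theta>'(x := v)) \<phi>" for v
    using Ex.prems by (intro Ex.IH) simp
  then show ?case by simp
qed

section \<open>Soundness of the assignment and array axioms\<close>

lemma those_map_Some: "those (map Some xs) = Some xs"
  by (induction xs) auto

text \<open>The old witness serves again, since the bound variables and the formula stay the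
  same.\<close>

lemma holds_update:
  assumes "holds \<tau> (r, m, X, \<phi>) (\<rho>, \<mu>)"
    and "\<And>\<theta>. teval \<theta> r = Some (VEnv \<rho>) \<Longrightarrow> teval \<theta> m = Some (VMem \<mu>) \<Longrightarrow>
      teval \<theta> r' = Some (VEnv \<rho>') \<and> teval \<theta> m' = Some (VMem \<mu>')"
  shows "holds \<tau> (r', m', X, \<phi>) (\<rho>', \<mu>')"
  using assms unfolding sat.simps by blast

lemma pstep_Assign_holds:
  assumes "holds \<tau> (r, m, X, \<phi>) s" "pstep (Some (Assign x e), s) (k, s')"
  shows "k = None \<and> holds \<tau> (tEnvUpd r x (tA r e), m, X, \<phi>) s'"
  using assms(2)
proof (rule pstep_AssignE)
  fix \<rho> v \<mu> assume "s = (\<rho>, \<mu>)" "s' = (fmupd x v \<rho>, \<mu>)" "k = None" "aval \<rho> e = Some v"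
  then show ?thesis
    by (auto intro!: holds_update[OF assms(1)[unfolded \<open>s = _\<close>]] simp del: sat.simps)
qed

lemma pstep_Lookup_holds:
  assumes "holds \<tau> (r, m, X, \<phi>) s" "pstep (Some (Lookup x A e), s) (k, s')"
  shows "k = None \<and> holds \<tau> (tEnvUpd r x (tMemLookup m (tAddr r A e)), m, X, \<phi>) s'"
  using assms(2)
proof (rule pstep_LookupE)
  fix \<rho> a i \<mu> v
  assume "s = (\<rho>, \<mu>)" "s' = (fmupd x v \<rho>, \<mu>)" "k = None"
    "fmlookup \<rho> A = Some a" "aval \<rho> e = Some i" "mem_lookup \<mu> (a + i) = Some v"
  then show ?thesis
    by (auto intro!: holds_update[OF assms(1)[unfolded \<open>s = _\<close>]] simp del: sat.simps)
qed

lemma pstep_Store_holds: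
  assumes "holds \<tau> (r, m, X, \<phi>) s" "pstep (Some (Store A e1 e2), s) (k, s')"
  shows "k = None \<and> holds \<tau> (r, tMemUpd m (tAddr r A e1) (tA r e2), X, \<phi>) s'"
  using assms(2)
proof (rule pstep_StoreE)
  fix \<rho> a i v \<mu> \<mu>'
  assume "s = (\<rho>, \<mu>)" "s' = (\<rho>, \<mu>')" "k = None"
    "fmlookup \<rho> A = Some a" "aval \<rho> e1 = Some i" "aval \<rho> e2 = Some v"
    "mem_update \<mu> (a + i) v = Some \<mu>'"
  then show ?thesis
    by (auto intro!: holds_update[OF assms(1)[unfolded \<open>s = _\<close>]] simp del: sat.simps)
qed

text \<open>The address chosen by the step becomes the value of \<open>p\<close>. Freshness of
  \<open>p\<close> keeps the values of \<open>r\<close>, \<open>m\<close> and \<phi>, and binding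
  \<open>p\<close> lets the new witness differ from \<tau> there.\<close>

lemma pstep_NewArray_holds:
  assumes "holds \<tau> (r, m, X, \<phi>) s" "pstep (Some (NewArray A es), s) (k, s')"
    and p: "fst p = IntS" "p \<notin> X \<union> tvars r \<union> tvars m \<union> fvars \<phi>"
  shows "k = None \<and>
    holds \<tau> (tEnvUpd r A (SVar p), tMemAlloc m (SVar p) (map (tA r) es), X \<union> {p}, \<phi>) s'"
proof -
  obtain \<rho> \<mu> where s: "s = (\<rho>, \<mu>)" by fastforce
  from assms(2)[unfolded s] obtain vs q \<mu>' where
    vs: "map (aval \<rho>) es = map Some vs" and alloc: "mem_alloc \<mu> q vs = Some \<mu>'"
    and k: "k = None" and s': "s' = (fmupd A q \<rho>, \<mu>')"
    by (rule pstep_NewArrayE) auto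
  from assms(1)[unfolded s] obtain \<theta> where
    \<theta>: "valuation \<theta>" "\<And>x. x \<notin> X \<Longrightarrow> \<theta> x = \<tau> x" "teval \<theta> r = Some (VEnv \<rho>)"
       "teval \<theta> m = Some (VMem \<mu>)" "fsat \<theta> \<phi>"
    by auto
  define \<theta>' where "\<theta>' = \<theta>(p := VInt q)"
  have "teval \<theta>' r = teval \<theta> r" "teval \<theta>' m = teval \<theta> m" "fsat \<theta>' \<phi> = fsat \<theta> \<phi>"
    using p unfolding \<theta>'_def by (auto intro!: teval_cong fsat_cong)
  with \<theta> have eval: "teval \<theta>' r = Some (VEnv \<rho>)" "teval \<theta>' m = Some (VMem \<mu>)" "fsat \<theta>' \<phi>"
    by simp_all
  \<comment> \<open>All array entries are defined, so \<open>those\<close> can collect them when the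
    allocation term is evaluated; \<open>ints\<close> then undoes the wrapping by
    \<open>VInt\<close>.\<close>
  have "map (teval \<theta>') (map (tA r) es) = map (map_option VInt) (map (aval \<rho>) es)"
    using eval by simp
  then have args: "map (teval \<theta>') (map (tA r) es) = map Some (map VInt vs)"
    unfolding vs by simp
  have ints: "map the_int (map VInt vs) = map Some vs"
    by simp
  have "teval \<theta>' (tEnvUpd r A (SVar p)) = Some (VEnv (fmupd A q \<rho>))"
    using eval by (simp add: \<theta>'_def)
  moreover have "teval \<theta>' (tMemAlloc m (SVar p) (map (tA r) es)) = Some (VMem \<mu>')"
    using eval(2) args alloc by (simp add: those_map_Some ints \<theta>'_def del: map_map)
  moreover have "valuation \<theta>'"
    using \<theta>(1) p(1) unfolding valuation_def \<theta>'_def by (metis fun_upd_apply sort_of.simps(1))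
  moreover have "\<forall>x. x \<notin> X \<union> {p} \<longrightarrow> \<theta>' x = \<tau> x"
    using \<theta>(2) by (simp add: \<theta>'_def)
  ultimately show ?thesis
    using k s' eval(3) by (simp del: teval.simps) blast
qed


section \<open>Outlines as rely-guarantee specifications\<close>

definition rely :: "(svar \<Rightarrow> 'u val) \<Rightarrow> 'u outline \<Rightarrow> env \<times> mem \<Rightarrow> env \<times> mem \<Rightarrow> bool" where
  "rely \<tau> \<Delta> s s' \<longleftrightarrow> (\<forall>(k, pre, post) \<in> \<Delta>. holds \<tau> pre s \<longrightarrow> holds \<tau> pre s')"

definition guar :: "(svar \<Rightarrow> 'u val) \<Rightarrow> 'u outline \<Rightarrow> env \<times> mem \<Rightarrow> env \<times> mem \<Rightarrow> bool" where
  "guar \<tau> \<Delta> s s' \<longleftrightarrow> s' = s \<or>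
     (\<exists>k pre post. (Some k, pre, post) \<in> \<Delta> \<and> atomic k \<and> holds \<tau> pre s \<and>
        pstep (Some k, s) (None, s'))"

abbreviation outline_safe ::
    "(svar \<Rightarrow> 'u val) \<Rightarrow> 'u outline \<Rightarrow> 'u pattern \<Rightarrow> com option \<Rightarrow> env \<times> mem \<Rightarrow> bool" where
  "outline_safe \<tau> \<Delta> \<Gamma>' \<equiv> safe (rely \<tau> \<Delta>) (guar \<tau> \<Delta>) (\<lambda>s. sat (None, s) \<tau> \<Gamma>')"

section \<open>Monotonicity in the outline and the use of interference-freedom\<close>

lemma rely_antimono: "rely \<tau> \<Delta>' s s' \<Longrightarrow> \<Delta> \<subseteq> \<Delta>' \<Longrightarrow> rely \<tau> \<Delta> s s'"
  unfolding rely_def by blast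

lemma guar_mono: "guar \<tau> \<Delta> s s' \<Longrightarrow> \<Delta> \<subseteq> \<Delta>' \<Longrightarrow> guar \<tau> \<Delta>' s s'"
  unfolding guar_def by blast

lemma guar_refl [simp]: "guar \<tau> \<Delta> s s"
  unfolding guar_def by simp

lemma rely_attach: "rely \<tau> (insert (attach \<Gamma> \<Gamma>') \<Delta>) s s' \<Longrightarrow> holds \<tau> (snd \<Gamma>) s \<Longrightarrow> holds \<tau> (snd \<Gamma>) s'"
  unfolding rely_def attach_def by auto

text \<open>A larger outline strengthens the rely and weakens the guarantee, so safety obtained from
  the premises of a rule carries over to the outline of its conclusion.\<close>

lemma outline_safe_mono:
  assumes "outline_safe \<tau> \<Delta> \<Gamma> k s" "\<Delta> \<subseteq> \<Delta>'"
    and "\<And>s. sat (None, s) \<tau> \<Gamma> \<Longrightarrow> sat (None, s) \<tau> \<Gamma>'"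
  shows "outline_safe \<tau> \<Delta>' \<Gamma>' k s"
  using assms(1)
proof (rule safe_mono)
  show "rely \<tau> \<Delta>' s s' \<Longrightarrow> rely \<tau> \<Delta> s s'" for s s'
    using assms(2) by (rule rely_antimono[rotated])
  show "guar \<tau> \<Delta> s s' \<Longrightarrow> guar \<tau> \<Delta>' s s'" for s s'
    using assms(2) by (rule guar_mono[rotated])
qed (rule assms(3))

text \<open>\<open>preserves\<close> speaks of complete runs of \<open>k\<close>, and one step to
  the empty computation is such a run.\<close>

lemma preserves_pstep:
  assumes "preserves k pre a" "valuation \<tau>" "holds \<tau> pre s" "pstep (Some k, s) (None, s')"
    and "holds \<tau> a s"
  shows "holds \<tau> a s'"
proof -
  have "sat (Some k, s) \<tau> (Some k, pre)" "sat (Some k, s) \<tau> (Some k, a)"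
    using assms(3,5) by (simp_all add: sat_iff_holds[of "Some k"])
  then show ?thesis
    using assms(1,2,4) unfolding preserves_def final_def by (metis fst_conv r_into_rtranclp)
qed

text \<open>A guaranteed step that changes the state is an atomic step from its precondition, the
  situation treated by \<open>not_interfering\<close>. Its clause on preconditions gives the rely,
  its clause on the postcondition the second claim.\<close>

lemma interference_free_guar:
  assumes "interference_free \<Delta>1 \<Gamma>1' \<Delta>2 \<Gamma>2'" "valuation \<tau>" "guar \<tau> \<Delta>1 s s'"
  shows "rely \<tau> \<Delta>2 s s'" "holds \<tau> (snd \<Gamma>2') s \<Longrightarrow> holds \<tau> (snd \<Gamma>2') s'"
proof -
  have "rely \<tau> \<Delta>2 s s' \<and> (holds \<tau> (snd \<Gamma>2') s \<longrightarrow> holds \<tau> (snd \<Gamma>2') s')"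
  proof (cases "s' = s")
    case True
    then show ?thesis by (simp add: rely_def)
  next
    case False
    then obtain k pre post where k: "(Some k, pre, post) \<in> \<Delta>1" "atomic k" "holds \<tau> pre s"
      "pstep (Some k, s) (None, s')"
      using assms(3) unfolding guar_def by blast
    then have "not_interfering k pre \<Delta>2 \<Gamma>2'"
      using assms(1) unfolding interference_free_def by blast
    then show ?thesis
      using preserves_pstep[OF _ assms(2) k(3,4)]
      unfolding not_interfering_def rely_def by fast
  qed
  then show "rely \<tau> \<Delta>2 s s'" "holds \<tau> (snd \<Gamma>2') s \<Longrightarrow> holds \<tau> (snd \<Gamma>2') s'"
    by blast+
qed

lemma interference_free_sym:
  "interference_free \<Delta>1 \<Gamma>1' \<Delta>2 \<Gamma>2' \<Longrightarrow> interference_free \<Delta>2 \<Gamma>2' \<Delta>1 \<Gamma>1'"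
  unfolding interference_free_def by blast

text \<open>The precondition belongs to the outline, so the rely keeps it until the command is
  executed, and the step then matches the second disjunct of \<open>guar\<close>.\<close>

lemma outline_safe_atomic:
  assumes "atomic c" "holds \<tau> a s"
    and step: "\<And>s k s'. holds \<tau> a s \<Longrightarrow> pstep (Some c, s) (k, s') \<Longrightarrow> k = None \<and> sat (None, s') \<tau> \<Gamma>'"
  shows "outline_safe \<tau> {attach (Some c, a) \<Gamma>'} \<Gamma>' (Some c) s"
proof (rule safe_invariant[where I = "holds \<tau> a"])
  show "holds \<tau> a s" by fact
next
  fix s s' assume "holds \<tau> a s" "rely \<tau> {attach (Some c, a) \<Gamma>'} s s'"
  then show "holds \<tau> a s'" using rely_attach by fastforce
next
  fix s k s' assume *: "holds \<tau> a s" "pstep (Some c, s) (k, s')"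
  with step have "k = None" "sat (None, s') \<tau> \<Gamma>'" by blast+
  moreover have "guar \<tau> {attach (Some c, a) \<Gamma>'} s s'"
    using * \<open>k = None\<close> \<open>atomic c\<close> unfolding guar_def attach_def by auto
  ultimately show "guar \<tau> {attach (Some c, a) \<Gamma>'} s s' \<and> outline_safe \<tau> {attach (Some c, a) \<Gamma>'} \<Gamma>' k s'"
    by simp
qed

text \<open>Each rule is matched by a closure property of \<open>safe\<close>. The induction
  generalises over the state because components are entered in states that the environment may have
  changed meanwhile; \<tau> stays fixed.\<close>

lemma derives_outline_safe:
  assumes "derives \<Delta> \<Gamma> \<Gamma>'" "valuation \<tau>" "sat (k, s) \<tau> \<Gamma>"
  shows "outline_safe \<tau> \<Delta> \<Gamma>' k s"
  using assms(1,3)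
proof (induction arbitrary: k s)
  case (M_Skip \<Gamma> \<rho> m X \<phi> \<Gamma>')
  then have "k = Some Skip" "holds \<tau> (snd \<Gamma>) s"
    by (simp_all add: sat_iff_holds[of k] del: sat.simps)
  \<comment> \<open>\<open>Skip\<close> is not atomic; its step is guaranteed because it leaves the
    state unchanged.\<close>
  moreover have "outline_safe \<tau> {attach \<Gamma> \<Gamma>'} \<Gamma>' (Some Skip) s"
  proof (rule safe_invariant[where I = "holds \<tau> (snd \<Gamma>)"])
    fix s k s' assume "holds \<tau> (snd \<Gamma>) s" "pstep (Some Skip, s) (k, s')"
    then show "guar \<tau> {attach \<Gamma> \<Gamma>'} s s' \<and> outline_safe \<tau> {attach \<Gamma> \<Gamma>'} \<Gamma>' k s'"
      using M_Skip.hyps by (auto elim!: pstep_SkipE simp del: sat.simps)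
  qed (use calculation rely_attach in blast)+
  ultimately show ?case by blast
next
  case (M_Asgn1 \<Gamma> x e \<rho> m X \<phi> \<Gamma>')
  then have "k = Some (Assign x e)" "holds \<tau> (\<rho>, m, X, \<phi>) s"
    by (simp_all add: sat_iff_holds[of k] del: sat.simps)
  then show ?case
    unfolding M_Asgn1.hyps
    by (simp del: sat.simps) (rule outline_safe_atomic; (rule pstep_Assign_holds)?; simp del: sat.simps)
next
  case (M_Asgn2 \<Gamma> x A e \<rho> m X \<phi> \<Gamma>')
  then have "k = Some (Lookup x A e)" "holds \<tau> (\<rho>, m, X, \<phi>) s"
    by (simp_all add: sat_iff_holds[of k] del: sat.simps)
  then show ?case
    unfolding M_Asgn2.hyps
    by (simp del: sat.simps) (rule outline_safe_atomic; (rule pstep_Lookup_holds)?; simp del: sat.simps)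
next
  case (M_Asgn3 \<Gamma> A e1 e2 \<rho> m X \<phi> \<Gamma>')
  then have "k = Some (Store A e1 e2)" "holds \<tau> (\<rho>, m, X, \<phi>) s"
    by (simp_all add: sat_iff_holds[of k] del: sat.simps)
  then show ?case
    unfolding M_Asgn3.hyps
    by (simp del: sat.simps) (rule outline_safe_atomic; (rule pstep_Store_holds)?; simp del: sat.simps)
next
  case (M_Array p X \<rho> m \<phi> \<Gamma> A es \<Gamma>')
  then have k: "k = Some (NewArray A es)" "holds \<tau> (\<rho>, m, X, \<phi>) s"
    by (simp_all add: sat_iff_holds[of k] del: sat.simps)
  show ?case
    unfolding M_Array.hyps(3,4) k(1)
    by (rule outline_safe_atomic)
      (use k(2) pstep_NewArray_holds[OF _ _ M_Array.hyps(1,2)] in \<open>simp_all del: sat.simps Un_insert_right\<close>)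
next
  case (M_Seq \<Delta>1 c1 \<rho>1 m1 X1 \<phi>1 \<rho>2 m2 X2 \<phi>2 \<Delta>2 c2 \<rho>3 m3 X3 \<phi>3 \<Gamma> \<Gamma>')
  define \<Delta> where "\<Delta> = insert (attach \<Gamma> \<Gamma>') (\<Delta>1 \<union> \<Delta>2)"
  \<comment> \<open>The assertion shared by the two premises: postcondition of \<open>c1\<close> and
    precondition of \<open>c2\<close>.\<close>
  define Q where "Q = holds \<tau> (\<rho>2, m2, X2, \<phi>2)"
  from M_Seq have k: "k = Some (Seq c1 c2)" "sat (Some c1, s) \<tau> (Some c1, \<rho>1, m1, X1, \<phi>1)"
    by (simp_all add: sat_iff_holds[of k] sat_iff_holds[of "Some c1"] del: sat.simps)
  have "safe (rely \<tau> \<Delta>) (guar \<tau> \<Delta>) Q (Some c1) s"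
    unfolding Q_def using M_Seq.IH(1)[OF k(2)]
    by (rule outline_safe_mono) (auto simp: \<Delta>_def simp del: sat.simps)
  moreover have "outline_safe \<tau> \<Delta> \<Gamma>' (Some c2) s" if "Q s" for s
  proof -
    from that have "sat (Some c2, s) \<tau> (Some c2, \<rho>2, m2, X2, \<phi>2)"
      unfolding Q_def by (simp add: sat_iff_holds[of "Some c2"] del: sat.simps)
    from M_Seq.IH(2)[OF this] show ?thesis
      unfolding M_Seq.hyps(4)[symmetric]
      by (rule outline_safe_mono) (auto simp: \<Delta>_def simp del: sat.simps)
  qed
  ultimately have "outline_safe \<tau> \<Delta> \<Gamma>' (seqK (Some c1) c2) s"
    by (rule safe_seq)
  then show ?case unfolding \<Delta>_def k(1) by simp
next
  case (M_If \<Delta>1 c1 \<rho> m X1 \<phi> b \<Gamma>' \<Delta>2 c2 \<Gamma> \<rho>' m' X2 \<phi>')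
  define \<Delta> where "\<Delta> = insert (attach \<Gamma> \<Gamma>') (\<Delta>1 \<union> \<Delta>2)"
  from M_If have k: "k = Some (If b c1 c2)" "holds \<tau> (snd \<Gamma>) s"
    by (simp_all add: sat_iff_holds[of k] del: sat.simps)
  \<comment> \<open>The state is arbitrary because interference may precede the test; the rely keeps
    the precondition until then.\<close>
  have then_branch: "outline_safe \<tau> \<Delta> \<Gamma>' (Some c1) s"
    if "holds \<tau> (snd \<Gamma>) s" "bval (fst s) b = Some True" for s
  proof -
    have "sat (Some c1, s) \<tau> (Some c1, \<rho>, m, X1, Conj \<phi> (tB \<rho> b))"
      using that M_If.hyps(3) by (simp add: sat_iff_holds[of "Some c1"] holds_Conj_tB del: sat.simps)
    from M_If.IH(1)[OF this] show ?thesis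
      by (rule outline_safe_mono) (auto simp: \<Delta>_def simp del: sat.simps)
  qed
  have else_branch: "outline_safe \<tau> \<Delta> \<Gamma>' (Some c2) s"
    if "holds \<tau> (snd \<Gamma>) s" "bval (fst s) b \<noteq> Some True" for s
  proof -
    have "sat (Some c2, s) \<tau> (Some c2, \<rho>, m, X1, Conj \<phi> (Neg (tB \<rho> b)))"
      using that M_If.hyps(3)
      by (simp add: sat_iff_holds[of "Some c2"] holds_Conj_Neg_tB del: sat.simps)
    from M_If.IH(2)[OF this] show ?thesis
      by (rule outline_safe_mono) (auto simp: \<Delta>_def simp del: sat.simps)
  qed
  have "outline_safe \<tau> \<Delta> \<Gamma>' (Some (If b c1 c2)) s"
  proof (rule safe_invariant[where I = "holds \<tau> (snd \<Gamma>)"])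
    fix s k s' assume I: "holds \<tau> (snd \<Gamma>) s" and "pstep (Some (If b c1 c2), s) (k, s')"
    from this(2) show "guar \<tau> \<Delta> s s' \<and> outline_safe \<tau> \<Delta> \<Gamma>' k s'"
      by (rule pstep_IfE) (use I then_branch else_branch in \<open>simp_all del: sat.simps\<close>)
  qed (use k(2) rely_attach \<Delta>_def in blast)+
  then show ?case unfolding \<Delta>_def k(1) .
next
  case (M_Cons \<Gamma> \<Gamma>1 \<Delta> \<Gamma>1' \<Gamma>')
  then have "sat (k, s) \<tau> \<Gamma>1"
    using assms(2) unfolding entails_def by blast
  from M_Cons.IH[OF this] show ?case
    by (rule outline_safe_mono) (use M_Cons.hyps(3) assms(2) in \<open>auto simp: entails_def\<close>)
next
  case (M_Case \<Gamma> \<Gamma>1 \<Gamma>2 \<Delta>1 \<Gamma>' \<Delta>2)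
  \<comment> \<open>The case is chosen once, in the current state; from then on the chosen
    derivation alone ensures safety.\<close>
  then have "sat (k, s) \<tau> \<Gamma>1 \<or> sat (k, s) \<tau> \<Gamma>2"
    using assms(2) unfolding entails_disj_def by blast
  then have "outline_safe \<tau> \<Delta>1 \<Gamma>' k s \<or> outline_safe \<tau> \<Delta>2 \<Gamma>' k s"
    using M_Case.IH by blast
  then show ?case
    by (auto elim!: outline_safe_mono)
next
  case (M_Await cc \<Delta> \<rho> m X1 \<phi> b \<Gamma>' \<Gamma>)
  then have k: "k = Some (Await b cc)" "holds \<tau> (\<rho>, m, X1, \<phi>) s"
    by (simp_all add: sat_iff_holds[of k] del: sat.simps)
  have "k' = None \<and> sat (None, s') \<tau> \<Gamma>'"
    if pre: "holds \<tau> (\<rho>, m, X1, \<phi>) s" and step: "pstep (Some (Await b cc), s) (k', s')" for s k' s'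
  proof -
    from step have *: "k' = None" "bval (fst s) b = Some True" "pstep\<^sup>*\<^sup>* (Some cc, s) (None, s')"
      by (auto elim: pstep_AwaitE)
    with pre have "sat (Some cc, s) \<tau> (Some cc, \<rho>, m, X1, Conj \<phi> (tB \<rho> b))"
      by (simp add: sat_iff_holds[of "Some cc"] holds_Conj_tB del: sat.simps)
    \<comment> \<open>The body runs inside one step and hence without interference, so safety for
      its internal outline \<Delta> already yields the postcondition.\<close>
    from safe_steps[OF *(3) M_Await.IH[OF this]] show ?thesis
      using *(1) by simp
  qed
  then show ?case
    unfolding M_Await.hyps(3) k(1) using k(2) by (intro outline_safe_atomic) simp_all
next
  case (M_While \<Delta> c \<rho> m X \<phi> b \<Gamma> \<Gamma>')
  define \<Delta>' where "\<Delta>' = insert (attach \<Gamma> \<Gamma>') \<Delta>"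
  define I where "I = holds \<tau> (\<rho>, m, X, \<phi>)"
  from M_While have k: "k = Some (While b c)" "I s"
    unfolding I_def by (simp_all add: sat_iff_holds[of k] del: sat.simps)
  have "outline_safe \<tau> \<Delta>' \<Gamma>' (Some (While b c)) s"
  proof (rule safe_while[where I = I])
    \<comment> \<open>The invariant is the precondition that \<open>attach\<close> records for the
      loop, so the rely preserves it.\<close>
    show "I s'" if "I s" "rely \<tau> \<Delta>' s s'" for s s'
      using that rely_attach[of \<tau> \<Gamma> \<Gamma>' \<Delta> s s'] M_While.hyps(2) unfolding I_def \<Delta>'_def by simp
    show "safe (rely \<tau> \<Delta>') (guar \<tau> \<Delta>') I (Some c) s" if "I s" "bval (fst s) b = Some True" for s
    proof -
      from that have "sat (Some c, s) \<tau> (Some c, \<rho>, m, X, Conj \<phi> (tB \<rho> b))"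
        unfolding I_def by (simp add: sat_iff_holds[of "Some c"] holds_Conj_tB del: sat.simps)
      from M_While.IH[OF this] show ?thesis
        unfolding I_def by (rule outline_safe_mono) (auto simp: \<Delta>'_def simp del: sat.simps)
    qed
    show "sat (None, s) \<tau> \<Gamma>'" if "I s" "bval (fst s) b \<noteq> Some True" for s
      using that unfolding I_def M_While.hyps(3) by (simp add: holds_Conj_Neg_tB del: sat.simps)
  qed (use k(2) in simp_all)
  then show ?case unfolding \<Delta>'_def k(1) .
next
  case (M_Par \<Gamma>1' \<rho>' m' X2 \<phi>1' \<Gamma>2' \<phi>2' \<Delta>1 c1 \<rho> m X1 \<phi>1 \<Delta>2 c2 \<phi>2 \<Gamma> \<Gamma>')
  define \<Delta> where
    "\<Delta> = insert (attach \<Gamma> \<Gamma>') ({component_end \<Gamma>1', component_end \<Gamma>2'} \<union> \<Delta>1 \<union> \<Delta>2)"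
  let ?Q1 = "\<lambda>s. sat (None, s) \<tau> \<Gamma>1'" and ?Q2 = "\<lambda>s. sat (None, s) \<tau> \<Gamma>2'"
  have Q1: "?Q1 s \<longleftrightarrow> holds \<tau> (snd \<Gamma>1') s" and Q2: "?Q2 s \<longleftrightarrow> holds \<tau> (snd \<Gamma>2') s" for s
    using M_Par.hyps(1,2) by simp_all
  \<comment> \<open>A witness for the conjunction serves for both components.\<close>
  from M_Par.prems have k: "k = Some (Par c1 c2)"
    and "sat (Some c1, s) \<tau> (Some c1, \<rho>, m, X1, \<phi>1)" "sat (Some c2, s) \<tau> (Some c2, \<rho>, m, X1, \<phi>2)"
    unfolding M_Par.hyps(6) by (cases s; auto)+
  from M_Par.IH(1)[OF this(2)] M_Par.IH(2)[OF this(3)]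
  have "outline_safe \<tau> \<Delta> \<Gamma>' (parK (Some c1) (Some c2)) s"
  proof (rule safe_par)
    show "guar \<tau> \<Delta> s s' \<and> rely \<tau> \<Delta>2 s s' \<and> (?Q2 s \<longrightarrow> ?Q2 s')" if "guar \<tau> \<Delta>1 s s'" for s s'
      using interference_free_guar[OF M_Par.hyps(5) assms(2) that] guar_mono[OF that, of \<Delta>]
      unfolding Q2 \<Delta>_def by blast
    show "guar \<tau> \<Delta> s s' \<and> rely \<tau> \<Delta>1 s s' \<and> (?Q1 s \<longrightarrow> ?Q1 s')" if "guar \<tau> \<Delta>2 s s'" for s s'
      using interference_free_guar[OF interference_free_sym[OF M_Par.hyps(5)] assms(2) that]
        guar_mono[OF that, of \<Delta>]
      unfolding Q1 \<Delta>_def by blast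
    \<comment> \<open>The \<open>component_end\<close> entries list both postconditions as
      preconditions of the empty computation, so the rely of \<Delta> preserves them too.\<close>
    show "rely \<tau> \<Delta>1 s s' \<and> rely \<tau> \<Delta>2 s s' \<and> (?Q1 s \<longrightarrow> ?Q1 s') \<and> (?Q2 s \<longrightarrow> ?Q2 s')"
      if "rely \<tau> \<Delta> s s'" for s s'
      using that unfolding Q1 Q2 \<Delta>_def rely_def component_end_def by auto
    show "sat (None, s) \<tau> \<Gamma>'" if "?Q1 s" "?Q2 s" for s
      using M_Par.hyps(8) assms(2) that unfolding conj_entails_def by blast
  qed
  then show ?case unfolding \<Delta>_def k by simp
qed

section \<open>Soundness along actual executions\<close>

theorem theorem10:
  fixes \<Gamma> \<Gamma>' :: "'u pattern" and \<Delta> :: "'u outline"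
    and \<tau> :: "svar \<Rightarrow> 'u val" and \<sigma> :: "config list" and ls :: "label list"
  assumes "derives \<Delta> \<Gamma> \<Gamma>'"
    and "valuation \<tau>"
    and "actual \<Delta> \<Gamma> \<Gamma>' \<tau> \<sigma> ls"
    and "sat (hd \<sigma>) \<tau> \<Gamma>"
  shows "sat (last \<sigma>) \<tau> \<Gamma>'"
proof -
  from assms(3) have len: "length \<sigma> = Suc (length ls)" and fin: "final (last \<sigma>)"
    and steps: "\<And>i. i < length ls \<Longrightarrow> step (ls ! i) (\<sigma> ! i) (\<sigma> ! Suc i)"
    unfolding actual_def terminable_def execution_def by simp_all
  from assms(3) obtain S where
    S: "\<forall>(\<Delta>1, \<Gamma>1, \<Gamma>1') \<in> S. derives \<Delta>1 \<Gamma>1 \<Gamma>1' \<and> interference_free \<Delta>1 \<Gamma>1' \<Delta> \<Gamma>'" and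
    perf: "\<forall>i < length ls. ls ! i = E \<longrightarrow> performed_by S \<tau> (\<sigma> ! i) (\<sigma> ! Suc i)"
    unfolding actual_def by (elim conjE exE)
  \<comment> \<open>A state-changing environment step lies in the guarantee of some member of
    \<open>S\<close>. Its interference-freedom with \<Delta> yields the rely and the stability of
    the postcondition that \<open>safe_env\<close> asks for.\<close>
  have env: "outline_safe \<tau> \<Delta> \<Gamma>' k s'"
    if "outline_safe \<tau> \<Delta> \<Gamma>' k s" "performed_by S \<tau> (k, s) (k, s')" for k s s'
  proof (cases "s' = s")
    case False
    with that(2) obtain \<Delta>1 \<Gamma>1 \<Gamma>1' where "(\<Delta>1, \<Gamma>1, \<Gamma>1') \<in> S" and guar: "guar \<tau> \<Delta>1 s s'"
      by (cases s; cases s') (fastforce simp: guar_def sat_iff_holds[of "Some _"] simp del: sat.simps)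
    note * = interference_free_guar[OF _ assms(2) guar, of \<Gamma>1' \<Delta> \<Gamma>']
    have free: "interference_free \<Delta>1 \<Gamma>1' \<Delta> \<Gamma>'"
      using S \<open>(\<Delta>1, \<Gamma>1, \<Gamma>1') \<in> S\<close> by fast
    from that(1) *(1)[OF free] show ?thesis
      by (rule safe_env) (use *(2)[OF free] sat_iff_holds in blast)
  qed (use that in simp)
  \<comment> \<open>Induction along the execution; the bound is inclusive because there is one more
    configuration than there are labels.\<close>
  have "outline_safe \<tau> \<Delta> \<Gamma>' (fst (\<sigma> ! i)) (snd (\<sigma> ! i))" if "i \<le> length ls" for i
    using that
  proof (induction i)
    case 0
    have "\<sigma> ! 0 = hd \<sigma>"
      using len by (cases \<sigma>) auto
    then show ?case
      using derives_outline_safe[OF assms(1,2)] assms(4) by simp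
  next
    case (Suc i)
    then have i: "i < length ls" and IH: "outline_safe \<tau> \<Delta> \<Gamma>' (fst (\<sigma> ! i)) (snd (\<sigma> ! i))"
      by simp_all
    from steps[OF i] show ?case
    proof cases
      case 1
      then have "pstep\<^sup>*\<^sup>* (fst (\<sigma> ! i), snd (\<sigma> ! i)) (fst (\<sigma> ! Suc i), snd (\<sigma> ! Suc i))"
        by simp
      then show ?thesis using IH by (rule safe_steps)
    next
      case (2 k \<rho> m \<rho>' m')
      then show ?thesis using env[of k "(\<rho>, m)" "(\<rho>', m')"] IH perf[rule_format, OF i] by (simp del: performed_by.simps)
    qed
  qed
  \<comment> \<open>This index belongs to the last configuration, which is final, so its safety
    amounts to the postcondition.\<close>
  from this[of "length ls"] have "outline_safe \<tau> \<Delta> \<Gamma>' (fst (last \<sigma>)) (snd (last \<sigma>))"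
    using len by (metis last_conv_nth diff_Suc_1 length_0_conv nat.distinct(1) order_refl)
  then show ?thesis
    using fin by (cases "last \<sigma>") (simp add: final_def)
qed

end
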